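(* Let $p$ be a Q-point on $\omega$. Then every element of $\mathscr F^p$ generates a free subsemigroup of $\beta\omega$; that is, for every $u\in\mathscr F^p$ and all $n,m\in\mathbb N$, $u^n=u^m$ holds if and only if $n=m$.
   Context: $\beta\omega$ is the set of ultrafilters on $\omega=\{0,1,2,\dots\}$, and $\mathbb N=\{1,2,\dots\}$. For $u,v\in\beta\omega$, $u+v=\{A\subseteq\omega : \{x\in\omega : \{y\in\omega : x+y\in A\}\in v\}\in u\}$, and $u^n=u+\cdots+u$ ($n$ summands). A Q-point is a nonprincipal ultrafilter $u$ on $\omega$ such that for every partition of $\omega$ into finite sets $F_n$ ($n<\omega$) there is $A\in u$ with $|A\cap F_n|\le 1$ for all $n$. For $u\in\beta\omega$ and a sequence $\langle u_n : n<\omega\rangle$ in $\beta\omega$, the Blass–Frolík sum is the ultrafilter on $\omega\times\omega$ given by $\{A\subseteq\omega\times\omega : \{n : \{m : (n,m)\in A\}\in u_n\}\in u\}$, and the indexed sum $\bigoplus_{u} u_n$ is its image under the map $(n,m)\mapsto n+m$, i.e. $\{A\subseteq\omega : \{n : \{m : n+m\in A\}\in u_n\}\in u\}$. For $p\in\beta\omega$ define $\mathscr F^p_0=\{p\}$, $\mathscr F^p_{\alpha+1}=\{\bigoplus_u u_n : u\in\mathscr F^p_\alpha \text{ and } u_n\in\mathscr F^p_\alpha\text{ for all } n<\omega\}$, $\mathscr F^p_\alpha=\bigcup_{\xi<\alpha}\mathscr F^p_\xi$ for limit $\alpha$, and $\mathscr F^p=\bigcup_{\alpha\in\mathbf{Ord}}\mathscr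 F^p_\alpha$. *)

theory Defs
  imports "HOL-Library.Disjoint_Sets"
begin

text \<open>
  Ultrafilters on a type are represented by the library's filters:
  \<open>A \<in> u\<close> is rendered as \<open>eventually (\<lambda>x. x \<in> A) u\<close>, and \<open>\<beta>\<omega>\<close> is the set of
  all \<open>u :: nat filter\<close> with \<open>ultrafilter u\<close>.
\<close>

definition ultrafilter :: "'a filter \<Rightarrow> bool" where
  "ultrafilter u \<longleftrightarrow>
     u \<noteq> bot \<and> (\<forall>P. eventually P u \<or> eventually (\<lambda>x. \<not> P x) u)"

text \<open>
  A partition of \<open>\<omega>\<close> into finite sets automatically has exactly countably infinitely many
  cells, so the indexing of the cells by \<open>\<omega>\<close> is left implicit.
\<close>

definition Q_point :: "nat filter \<Rightarrow> bool" where
  "Q_point u \<longleftrightarrow> ultrafilter u \<and> (\<forall>n. u \<noteq> principal {n}) \<and>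
     (\<forall>\<P>. partition_on UNIV \<P> \<and> (\<forall>F\<in>\<P>. finite F) \<longrightarrow>
        (\<exists>A. eventually (\<lambda>x. x \<in> A) u \<and> (\<forall>F\<in>\<P>. card (A \<inter> F) \<le> 1)))"

definition uf_plus :: "nat filter \<Rightarrow> nat filter \<Rightarrow> nat filter" where
  "uf_plus u v = Abs_filter (\<lambda>P. eventually (\<lambda>x. eventually (\<lambda>y. P (x + y)) v) u)"

text \<open>\<open>uf_power u n\<close> is the sum of \<open>n\<close> copies of \<open>u\<close>; only \<open>n \<ge> 1\<close> is meaningful.\<close>

definition uf_power :: "nat filter \<Rightarrow> nat \<Rightarrow> nat filter" where
  "uf_power u n = (uf_plus u ^^ (n - 1)) u"

definition Blass_Frolik_sum :: "nat filter \<Rightarrow> (nat \<Rightarrow> nat filter) \<Rightarrow> (nat \<times> nat) filter" where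
  "Blass_Frolik_sum u v = Abs_filter (\<lambda>P. eventually (\<lambda>n. eventually (\<lambda>m. P (n, m)) (v n)) u)"

definition indexed_sum :: "nat filter \<Rightarrow> (nat \<Rightarrow> nat filter) \<Rightarrow> nat filter" where
  "indexed_sum u v = filtermap (\<lambda>(n, m). n + m) (Blass_Frolik_sum u v)"

definition indexed_sums :: "nat filter set \<Rightarrow> nat filter set" where
  "indexed_sums S = {indexed_sum u v | u v. u \<in> S \<and> (\<forall>n. v n \<in> S)}"

text \<open>
  Ordinals are represented as elements \<open>\<alpha> \<in> Field r\<close> of a well-order \<open>r\<close>: such an \<open>\<alpha>\<close> stands
  for the order type of its set \<open>underS r \<alpha>\<close> of strict predecessors, and it is the successor
  of \<open>\<beta>\<close> iff \<open>underS r \<alpha> = under r \<beta>\<close>.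
\<close>

definition is_succ_of :: "'i rel \<Rightarrow> 'i \<Rightarrow> 'i \<Rightarrow> bool" where
  "is_succ_of r \<beta> \<alpha> \<longleftrightarrow> \<beta> \<in> Field r \<and> underS r \<alpha> = under r \<beta>"

definition sum_level :: "'i rel \<Rightarrow> nat filter \<Rightarrow> 'i \<Rightarrow> nat filter set" where
  "sum_level r p = wo_rel.worec r (\<lambda>\<F> \<alpha>.
     if underS r \<alpha> = {} then {p}
     else if \<exists>\<beta>. is_succ_of r \<beta> \<alpha> then indexed_sums (\<F> (THE \<beta>. is_succ_of r \<beta> \<alpha>))
     else (\<Union>\<xi>\<in>underS r \<alpha>. \<F> \<xi>))"

text \<open>
  The union of the levels over all ordinals that are represented in well-orders on subsets of
  the type \<open>'i\<close>. HOL has no type of all ordinals; statements about all elements of the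
  full union are made with \<open>'i\<close> an arbitrary type variable.
\<close>

definition sum_closure :: "'i itself \<Rightarrow> nat filter \<Rightarrow> nat filter set" where
  "sum_closure (_ :: 'i itself) p =
     (\<Union>r \<in> {r :: 'i rel. Well_order r}. \<Union>\<alpha>\<in>Field r. sum_level r p \<alpha>)"


subsection \<open>The definitions agree with their set-theoretic descriptions\<close>

lemma eventually_uf_plus:
  "eventually P (uf_plus u v) \<longleftrightarrow> eventually (\<lambda>x. eventually (\<lambda>y. P (x + y)) v) u"
  unfolding uf_plus_def
  by (rule eventually_Abs_filter, rule is_filter.intro)
     (simp, simp add: eventually_conj_iff, (erule eventually_mono, erule eventually_mono, simp))

lemma eventually_Blass_Frolik_sum:
  "eventually P (Blass_Frolik_sum u v) \<longleftrightarrow>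
     eventually (\<lambda>n. eventually (\<lambda>m. P (n, m)) (v n)) u"
  unfolding Blass_Frolik_sum_def
  by (rule eventually_Abs_filter, rule is_filter.intro)
     (simp, simp add: eventually_conj_iff, (erule eventually_mono, erule eventually_mono, simp))

lemma eventually_indexed_sum:
  "eventually P (indexed_sum u v) \<longleftrightarrow>
     eventually (\<lambda>n. eventually (\<lambda>m. P (n + m)) (v n)) u"
  by (simp add: indexed_sum_def eventually_filtermap eventually_Blass_Frolik_sum)

lemma ultrafilter_indexed_sum:
  assumes u: "ultrafilter u" and v: "\<And>n. ultrafilter (v n)"
  shows "ultrafilter (indexed_sum u v)"
proof -
  have "eventually P (indexed_sum u v) \<or> eventually (\<lambda>x. \<not> P x) (indexed_sum u v)" for P
  proof -
    have *: "eventually (\<lambda>m. \<not> P (n + m)) (v n)"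
      if "\<not> eventually (\<lambda>m. P (n + m)) (v n)" for n
      using v[of n] that unfolding ultrafilter_def by blast
    have "eventually (\<lambda>n. eventually (\<lambda>m. P (n + m)) (v n)) u \<or>
          eventually (\<lambda>n. \<not> eventually (\<lambda>m. P (n + m)) (v n)) u"
      using u unfolding ultrafilter_def by blast
    then show ?thesis
      unfolding eventually_indexed_sum
    proof (elim disjE)
      assume "eventually (\<lambda>n. \<not> eventually (\<lambda>m. P (n + m)) (v n)) u"
      then have "eventually (\<lambda>n. eventually (\<lambda>m. \<not> P (n + m)) (v n)) u"
        by (rule eventually_mono) (rule *)
      then show "eventually (\<lambda>n. eventually (\<lambda>m. P (n + m)) (v n)) u \<or>
          eventually (\<lambda>n. eventually (\<lambda>m. \<not> P (n + m)) (v n)) u" ..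
    qed (rule disjI1)
  qed
  moreover have "indexed_sum u v \<noteq> bot"
    using u v unfolding trivial_limit_def eventually_indexed_sum ultrafilter_def by simp
  ultimately show ?thesis
    unfolding ultrafilter_def by blast
qed

context
  fixes r :: "'i rel"
  assumes wo: "Well_order r"
begin

lemma is_succ_of_unique:
  assumes "is_succ_of r \<beta> \<alpha>" "is_succ_of r \<gamma> \<alpha>"
  shows "\<beta> = \<gamma>"
proof -
  interpret wo_rel r using wo by (simp add: wo_rel_def)
  have "under \<beta> = under \<gamma>" "\<beta> \<in> Field r" "\<gamma> \<in> Field r"
    using assms by (auto simp: is_succ_of_def)
  then have "(\<beta>, \<gamma>) \<in> r" "(\<gamma>, \<beta>) \<in> r"
    using REFL by (auto simp: under_def refl_on_def)
  then show ?thesis using ANTISYM by (auto simp: antisym_def)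
qed

lemma is_succ_of_underS:
  assumes "is_succ_of r \<beta> \<alpha>"
  shows "\<beta> \<in> underS r \<alpha>"
proof -
  interpret wo_rel r using wo by (simp add: wo_rel_def)
  show ?thesis
    using assms REFL by (auto simp: is_succ_of_def under_def refl_on_def)
qed

lemma sum_level_unfold:
  "sum_level r p \<alpha> =
     (if underS r \<alpha> = {} then {p}
      else if \<exists>\<beta>. is_succ_of r \<beta> \<alpha> then indexed_sums (sum_level r p (THE \<beta>. is_succ_of r \<beta> \<alpha>))
      else (\<Union>\<xi>\<in>underS r \<alpha>. sum_level r p \<xi>))"
proof -
  interpret wo_rel r using wo by (simp add: wo_rel_def)
  have the: "(THE \<beta>. is_succ_of r \<beta> \<alpha>) = \<beta>" if "is_succ_of r \<beta> \<alpha>" for \<alpha> \<beta>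
    using that is_succ_of_unique by blast
  have "adm_wo (\<lambda>\<F> \<alpha>.
     if underS \<alpha> = {} then {p}
     else if \<exists>\<beta>. is_succ_of r \<beta> \<alpha> then indexed_sums (\<F> (THE \<beta>. is_succ_of r \<beta> \<alpha>))
     else (\<Union>\<xi>\<in>underS \<alpha>. \<F> \<xi>))"
    unfolding adm_wo_def by (auto simp: the is_succ_of_underS)
  from fun_cong[OF worec_fixpoint[OF this], of \<alpha>] show ?thesis
    unfolding sum_level_def .
qed

lemma sum_level_zero:
  "underS r \<alpha> = {} \<Longrightarrow> sum_level r p \<alpha> = {p}"
  by (subst sum_level_unfold) simp

lemma sum_level_succ:
  assumes "is_succ_of r \<beta> \<alpha>"
  shows "sum_level r p \<alpha> = indexed_sums (sum_level r p \<beta>)"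
proof -
  have "(THE \<beta>. is_succ_of r \<beta> \<alpha>) = \<beta>"
    using assms is_succ_of_unique by blast
  then show ?thesis
    using assms is_succ_of_underS[OF assms] by (subst sum_level_unfold) auto
qed

lemma sum_level_limit:
  assumes "underS r \<alpha> \<noteq> {}" "\<nexists>\<beta>. is_succ_of r \<beta> \<alpha>"
  shows "sum_level r p \<alpha> = (\<Union>\<xi>\<in>underS r \<alpha>. sum_level r p \<xi>)"
  using assms by (subst sum_level_unfold) simp

end

end

theory Submission
  imports Defs "HOL-Library.Log_Nat"
begin

text \<open>
  A Q-point \<open>p\<close> contains a set \<open>A\<close> in which every element exceeds the sum of all smaller ones, so
  that a finite subset of \<open>A\<close> is determined by its sum. By induction along the levels, each
  \<open>u \<in> \<F>\<^sup>p\<close> concentrates on the sums of the members of a family \<open>B\<close> of nonempty finite subsets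
  of \<open>A\<close>, none of which is a proper initial segment of another, and these members can be taken
  arbitrarily far out: for an indexed sum, one appends to each member of the family for the index
  ultrafilter the members, lying beyond it, of the family of the corresponding summand.
  If \<open>u\<close> and \<open>v\<close> have such families, then \<open>u + v\<close> concentrates on sums of proper end extensions
  of members of \<open>B\<close>, hence \<open>u + v \<noteq> u\<close>. In particular \<open>u\<^sup>n + u\<^sup>d \<noteq> u\<^sup>n\<close>.
\<close>

section \<open>Superincreasing sets and uniqueness of finite sums\<close>

definition superincreasing :: "nat set \<Rightarrow> bool" where
  "superincreasing A \<longleftrightarrow> (\<forall>b\<in>A. \<forall>s\<subseteq>A \<inter> {..<b}. \<Sum>s < b)"

text \<open>Induction on the largest element \<open>c\<close> of \<open>s\<close>: the rest sums to
  less than \<open>c\<close>, so the total is below \<open>2 * c\<close>, which is at most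
  \<open>b\<close>.\<close>

lemma superincreasing_if_doubling:
  assumes pos: "\<And>a. a \<in> A \<Longrightarrow> 0 < a"
    and dbl: "\<And>a b. a \<in> A \<Longrightarrow> b \<in> A \<Longrightarrow> a < b \<Longrightarrow> 2 * a \<le> b"
  shows "superincreasing A"
proof -
  have "\<Sum>s < b" if "finite s" "s \<subseteq> A \<inter> {..<b}" "b \<in> A" for s b
    using that
  proof (induction s arbitrary: b rule: finite_linorder_max_induct)
    case empty
    then show ?case using pos by simp
  next
    case (insert c s)
    then have "\<Sum>s < c" by blast
    moreover have "2 * c \<le> b" using insert.prems dbl by auto
    moreover have "\<Sum>(insert c s) = c + \<Sum>s"
      using insert.hyps by (subst sum.insert) auto
    ultimately show ?case by linarith
  qed
  then show ?thesis
    unfolding superincreasing_def by (meson finite_Int finite_lessThan finite_subset)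
qed

text \<open>The sum determines the maximum, because everything below an element of \<open>A\<close>
  sums to less than that element. Removing the common maximum leaves smaller sets with equal
  sums.\<close>

lemma superincreasing_sum_inject:
  assumes A: "superincreasing A"
    and "finite s" "finite t" "s \<subseteq> A" "t \<subseteq> A" "\<Sum>s = \<Sum>t"
  shows "s = t"
  using assms(2-)
proof (induction s arbitrary: t rule: finite_linorder_max_induct)
  case empty
  \<comment> \<open>The case of the empty set \<open>s\<close> in the definition.\<close>
  have "\<forall>b\<in>A. 0 < b"
    using A by (force simp: superincreasing_def)
  then have "t = {}"
    using empty by (force simp: sum_eq_0_iff)
  then show ?case by simp
next
  case (insert b s)
  have bound: "\<Sum>r < c" if "c \<in> A" "r \<subseteq> A" "\<forall>x\<in>r. x < c" for r c
    using A that unfolding superincreasing_def by (metis Int_subset_iff lessThan_iff subsetI)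
  have sum_b: "\<Sum>(insert b s) = b + \<Sum>s"
    using insert.hyps by (subst sum.insert) auto
  have "t \<noteq> {}"
    using bound[of b "{}"] insert.prems sum_b by auto
  define c where "c = Max t"
  have c: "c \<in> t" "\<forall>x\<in>t. x \<le> c"
    using \<open>finite t\<close> \<open>t \<noteq> {}\<close> by (auto simp: c_def)
  have sum_c: "\<Sum>t = c + \<Sum>(t - {c})"
    using \<open>finite t\<close> c by (rule_tac sum.remove)
  \<comment> \<open>Otherwise \<open>t\<close> lies below \<open>b\<close>, so its sum is less than
    \<open>b\<close> and cannot equal \<open>b + \<Sum>s\<close>.\<close>
  have "\<not> c < b"
    using bound[of b t] c insert.prems sum_b by fastforce
  moreover have "\<not> b < c"
    using bound[of c "insert b s"] c insert.prems insert.hyps sum_c by fastforce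
  ultimately have "c = b" by simp
  then have "s = t - {c}"
    using insert.prems sum_b sum_c by (intro insert.IH) auto
  then show ?case using c \<open>c = b\<close> by auto
qed

section \<open>Superincreasing sets in a Q-point\<close>

lemma Q_point_inj_on:
  assumes "Q_point u" and "\<And>k. finite {x. f x = k}"
  obtains A where "eventually (\<lambda>x. x \<in> A) u" "inj_on f A"
proof -
  \<comment> \<open>The fibres are indexed by points rather than by values, since the cells of a
    partition must be nonempty.\<close>
  define \<P> where "\<P> = range (\<lambda>x. {y. f y = f x})"
  have "partition_on UNIV \<P>"
    by (auto simp: partition_on_def disjoint_def \<P>_def)
  moreover have "\<forall>F\<in>\<P>. finite F"
    using assms(2) by (auto simp: \<P>_def)
  ultimately obtain A where A: "eventually (\<lambda>x. x \<in> A) u" "\<forall>F\<in>\<P>. card (A \<inter> F) \<le> 1"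
    using assms(1) unfolding Q_point_def by blast
  have "inj_on f A"
  proof (rule inj_onI)
    fix x y assume xy: "x \<in> A" "y \<in> A" "f x = f y"
    have "card (A \<inter> {z. f z = f x}) \<le> 1"
      using A(2) by (auto simp: \<P>_def)
    then show "x = y"
      using xy assms(2)[of "f x"] by (auto simp: card_le_Suc0_iff_eq)
  qed
  then show thesis using A that by blast
qed

lemma Q_point_eventually_gt:
  assumes "Q_point u"
  shows "eventually (\<lambda>x. k < x) u"
proof -
  have "eventually (\<lambda>x. x \<noteq> n) u" for n
  proof (rule ccontr)
    assume "\<not> eventually (\<lambda>x. x \<noteq> n) u"
    then have eq: "eventually (\<lambda>x. x = n) u"
      using assms unfolding Q_point_def ultrafilter_def by force
    have "eventually P u \<longleftrightarrow> P n" for P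
    proof
      assume "eventually P u"
      with eq have "eventually (\<lambda>x. P n) u" by eventually_elim simp
      then show "P n"
        using assms by (auto simp: Q_point_def ultrafilter_def eventually_const_iff)
    next
      assume "P n"
      with eq show "eventually P u" by (auto elim: eventually_mono)
    qed
    then have "u = principal {n}"
      by (simp add: filter_eq_iff eventually_principal)
    then show False using assms by (auto simp: Q_point_def)
  qed
  then have "eventually (\<lambda>x. \<forall>n\<in>{..k}. x \<noteq> n) u"
    by (intro eventually_ball_finite) auto
  then show ?thesis by eventually_elim (auto simp: not_le[symmetric])
qed

text \<open>\<open>floorlog 2 x\<close> is the number of binary digits of \<open>x\<close>, so its
  fibres are finite dyadic blocks. The Q-point selects at most one element per block and fixes the
  parity of the length; distinct selected elements are then at least two blocks apart.\<close>

lemma Q_point_superincreasing: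
  assumes "Q_point p"
  obtains A where "superincreasing A" "eventually (\<lambda>x. x \<in> A) p"
proof -
  have bounds: "x < 2 ^ floorlog 2 x" "x > 0 \<Longrightarrow> 2 ^ (floorlog 2 x - 1) \<le> x" for x
    using floorlog_bounds[of x 2] by (cases "x = 0"; auto)+
  have "finite {x. floorlog 2 x = k}" for k
    by (rule finite_subset[of _ "{..<2 ^ k}"]) (use bounds in auto)
  then obtain A where A: "eventually (\<lambda>x. x \<in> A) p" "inj_on (floorlog 2) A"
    using Q_point_inj_on[OF assms] by metis
  have "eventually (\<lambda>x. even (floorlog 2 x)) p \<or> eventually (\<lambda>x. odd (floorlog 2 x)) p"
    using assms by (auto simp: Q_point_def ultrafilter_def)
  then obtain c where "eventually (\<lambda>x. even (floorlog 2 x) = c) p"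
    by (auto elim: meta_allE[of _ True] meta_allE[of _ False])
  with A(1) Q_point_eventually_gt[OF assms, of 0]
  have "eventually (\<lambda>x. x \<in> {x \<in> A. 0 < x \<and> even (floorlog 2 x) = c}) p"
    by eventually_elim simp
  moreover have "superincreasing {x \<in> A. 0 < x \<and> even (floorlog 2 x) = c}"
  proof (rule superincreasing_if_doubling)
    fix a b
    assume a: "a \<in> {x \<in> A. 0 < x \<and> even (floorlog 2 x) = c}"
      and b: "b \<in> {x \<in> A. 0 < x \<and> even (floorlog 2 x) = c}" and "a < b"
    have "floorlog 2 a \<noteq> floorlog 2 b"
      using A(2) a b \<open>a < b\<close> by (auto dest: inj_onD)
    moreover have "floorlog 2 a \<le> floorlog 2 b"
      using \<open>a < b\<close> by (intro floorlog_mono) simp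
    moreover have "even (floorlog 2 a) = even (floorlog 2 b)"
      using a b by auto
    \<comment> \<open>Distinct lengths of equal parity differ by at least 2. One unit pays for the
      factor 2, the other for the lower bound \<open>2 ^ (floorlog 2 b - 1)\<close> on
      \<open>b\<close>.\<close>
    ultimately have "Suc (floorlog 2 a) \<le> floorlog 2 b - 1"
      by presburger
    then have "(2::nat) ^ Suc (floorlog 2 a) \<le> 2 ^ (floorlog 2 b - 1)"
      by (intro power_increasing) auto
    then show "2 * a \<le> b"
      using bounds(1)[of a] bounds(2)[of b] b by auto
  qed auto
  ultimately show thesis using that by blast
qed

section \<open>Families of finite sets without proper initial segments\<close>

definition initial_segment :: "'a::linorder set \<Rightarrow> 'a set \<Rightarrow> bool" where
  "initial_segment s t \<longleftrightarrow> s \<subseteq> t \<and> (\<forall>x\<in>s. \<forall>y\<in>t - s. x < y)"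

lemma initial_segment_Un:
  "(\<And>x y. x \<in> s \<Longrightarrow> y \<in> t \<Longrightarrow> x < y) \<Longrightarrow> initial_segment s (s \<union> t)"
  by (auto simp: initial_segment_def)

lemma initial_segment_trans:
  "initial_segment r s \<Longrightarrow> initial_segment s t \<Longrightarrow> initial_segment r t"
  unfolding initial_segment_def by blast

text \<open>If \<open>x\<close> were in \<open>r - s\<close> and \<open>y\<close> in
  \<open>s - r\<close>, the two hypotheses would give both \<open>x < y\<close> and
  \<open>y < x\<close>.\<close>

lemma initial_segment_comparable:
  assumes "initial_segment r t" "initial_segment s t"
  shows "initial_segment r s \<or> initial_segment s r"
proof -
  have "r \<subseteq> s \<or> s \<subseteq> r"
    using assms unfolding initial_segment_def by (meson DiffI less_asym subsetD subsetI)
  then show ?thesis using assms unfolding initial_segment_def by blast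
qed

text \<open>The second clause is the thinness condition of Nash-Williams theory.\<close>

definition front_on :: "nat set \<Rightarrow> nat set set \<Rightarrow> bool" where
  "front_on A B \<longleftrightarrow> (\<forall>s\<in>B. finite s \<and> s \<noteq> {} \<and> s \<subseteq> A) \<and>
     (\<forall>s\<in>B. \<forall>t\<in>B. initial_segment s t \<longrightarrow> s = t)"

text \<open>The bound \<open>k\<close> allows a member to be chosen beyond any finite set fixed
  earlier; \<open>u \<noteq> bot\<close> allows witnesses to be extracted from eventual
  statements.\<close>

definition lives_on_front :: "nat filter \<Rightarrow> nat set set \<Rightarrow> bool" where
  "lives_on_front u B \<longleftrightarrow>
     u \<noteq> bot \<and> (\<forall>k. eventually (\<lambda>n. \<exists>s\<in>B. (\<forall>x\<in>s. k < x) \<and> n = \<Sum>s) u)"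

lemma front_on_append:
  assumes B: "front_on A B" and C: "\<And>n. front_on A (C n)"
  shows "front_on A {s \<union> t | s t. s \<in> B \<and> t \<in> C (\<Sum>s) \<and> (\<forall>x\<in>s. \<forall>y\<in>t. x < y)}"
    (is "front_on A ?D")
  unfolding front_on_def
proof (intro conjI ballI impI)
  fix r r' assume "r \<in> ?D" "r' \<in> ?D" and seg: "initial_segment r r'"
  then obtain s t s' t' where r: "r = s \<union> t" "s \<in> B" "t \<in> C (\<Sum>s)" "\<forall>x\<in>s. \<forall>y\<in>t. x < y"
    and r': "r' = s' \<union> t'" "s' \<in> B" "t' \<in> C (\<Sum>s')" "\<forall>x\<in>s'. \<forall>y\<in>t'. x < y"
    by blast
  \<comment> \<open>Both heads begin the same set \<open>r'\<close>, so they are comparable and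
    hence equal. The tails then come from the same family \<open>C (\<Sum>s)\<close>.\<close>
  have "initial_segment s r'" "initial_segment s' r'"
    using r r' seg initial_segment_Un initial_segment_trans by metis+
  then have eq: "s = s'"
    using initial_segment_comparable B r(2) r'(2) unfolding front_on_def by metis
  have "s \<inter> t = {}" "s \<inter> t' = {}"
    using r(4) r'(4) eq by fastforce+
  then have "initial_segment t t'"
    using seg r(1) r'(1) eq unfolding initial_segment_def by blast
  then show "r = r'"
    using C r r' eq unfolding front_on_def by blast
qed (use assms in \<open>auto simp: front_on_def\<close>)

lemma lives_on_front_indexed_sum:
  assumes u: "lives_on_front u B" and v: "\<And>n. lives_on_front (v n) (C n)"
    and B: "\<And>s. s \<in> B \<Longrightarrow> finite s" and C: "\<And>n t. t \<in> C n \<Longrightarrow> finite t"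
  shows "lives_on_front (indexed_sum u v)
    {s \<union> t | s t. s \<in> B \<and> t \<in> C (\<Sum>s) \<and> (\<forall>x\<in>s. \<forall>y\<in>t. x < y)}" (is "lives_on_front _ ?D")
  unfolding lives_on_front_def
proof (intro conjI allI)
  show "indexed_sum u v \<noteq> bot"
    using u v unfolding trivial_limit_def eventually_indexed_sum lives_on_front_def by simp
  fix k
  have "eventually (\<lambda>n. \<exists>s\<in>B. (\<forall>x\<in>s. k < x) \<and> n = \<Sum>s) u"
    using u unfolding lives_on_front_def by blast
  then have "eventually (\<lambda>n. eventually (\<lambda>m. \<exists>r\<in>?D. (\<forall>x\<in>r. k < x) \<and> n + m = \<Sum>r) (v n)) u"
  proof eventually_elim
    case (elim n)
    then obtain s where s: "s \<in> B" "\<forall>x\<in>s. k < x" "n = \<Sum>s" by blast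
    \<comment> \<open>The bound \<open>max k (Max s)\<close> places \<open>t\<close> beyond both
      \<open>k\<close> and \<open>s\<close>.\<close>
    have "eventually (\<lambda>m. \<exists>t\<in>C n. (\<forall>y\<in>t. max k (Max s) < y) \<and> m = \<Sum>t) (v n)"
      using v unfolding lives_on_front_def by blast
    then show ?case
    proof eventually_elim
      case (elim m)
      then obtain t where t: "t \<in> C n" "\<forall>y\<in>t. max k (Max s) < y" "m = \<Sum>t" by blast
      have less: "x < y" if "x \<in> s" "y \<in> t" for x y
        using that t(2) Max_ge[OF B[OF s(1)] that(1)] by fastforce
      then have "\<Sum>(s \<union> t) = n + m"
        using s t B C by (subst sum.union_disjoint) fastforce+
      moreover have "s \<union> t \<in> ?D"
        by (rule CollectI, rule exI[of _ s], rule exI[of _ t]) (use s t less in simp)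
      moreover have "\<forall>x\<in>s \<union> t. k < x"
        using s t by auto
      ultimately show ?case by (intro bexI[of _ "s \<union> t"] conjI) simp_all
    qed
  qed
  then show "eventually (\<lambda>n. \<exists>r\<in>?D. (\<forall>x\<in>r. k < x) \<and> n = \<Sum>r) (indexed_sum u v)"
    unfolding eventually_indexed_sum .
qed

definition has_front :: "nat set \<Rightarrow> nat filter \<Rightarrow> bool" where
  "has_front A u \<longleftrightarrow> (\<exists>B. front_on A B \<and> lives_on_front u B)"

lemma has_front_Q_point:
  assumes "Q_point p" "eventually (\<lambda>x. x \<in> A) p"
  shows "has_front A p"
  unfolding has_front_def
proof (intro exI conjI)
  show "front_on A ((\<lambda>a. {a}) ` A)"
    by (auto simp: front_on_def initial_segment_def)
  show "lives_on_front p ((\<lambda>a. {a}) ` A)"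
    unfolding lives_on_front_def
  proof (intro conjI allI)
    show "p \<noteq> bot" using assms by (auto simp: Q_point_def ultrafilter_def)
    show "eventually (\<lambda>n. \<exists>s\<in>(\<lambda>a. {a}) ` A. (\<forall>x\<in>s. k < x) \<and> n = \<Sum>s) p" for k
      using assms(2) Q_point_eventually_gt[OF assms(1), of k] by eventually_elim simp
  qed
qed

lemma has_front_indexed_sum:
  assumes "has_front A u" and "\<And>n. has_front A (v n)"
  shows "has_front A (indexed_sum u v)"
proof -
  obtain B where B: "front_on A B" "lives_on_front u B"
    using assms(1) has_front_def by blast
  obtain C where C: "\<And>n. front_on A (C n)" "\<And>n. lives_on_front (v n) (C n)"
    using assms(2) unfolding has_front_def by metis
  have fin: "\<And>s. s \<in> B \<Longrightarrow> finite s" "\<And>n t. t \<in> C n \<Longrightarrow> finite t"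
    using B(1) C(1) unfolding front_on_def by blast+
  show ?thesis
    unfolding has_front_def
    by (intro exI conjI)
      (rule front_on_append[where C = C], rule B, rule C,
        rule lives_on_front_indexed_sum, rule B, rule C, erule fin, erule fin)
qed

section \<open>Powers, and why adding on the right changes an ultrafilter\<close>

lemma uf_plus_eq_indexed_sum: "uf_plus u v = indexed_sum u (\<lambda>_. v)"
  by (simp add: filter_eq_iff eventually_uf_plus eventually_indexed_sum)

lemma uf_plus_assoc: "uf_plus (uf_plus u v) w = uf_plus u (uf_plus v w)"
  by (simp add: filter_eq_iff eventually_uf_plus add.assoc)

text \<open>Truncated subtraction makes \<open>uf_power u 0\<close> equal to \<open>u\<close>, so
  the laws of exponents are stated for positive exponents.\<close>

lemma uf_power_Suc: "n \<ge> 1 \<Longrightarrow> uf_power u (Suc n) = uf_plus u (uf_power u n)"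
  by (cases n) (auto simp: uf_power_def)

lemma uf_power_add:
  assumes "n \<ge> 1" "d \<ge> 1"
  shows "uf_power u (n + d) = uf_plus (uf_power u n) (uf_power u d)"
  using assms(1)
proof (induction n rule: dec_induct)
  case base
  then show ?case using uf_power_Suc[OF assms(2)] by (simp add: uf_power_def)
next
  case (step n)
  then show ?case by (simp add: uf_power_Suc uf_plus_assoc)
qed

lemma has_front_uf_power:
  assumes "has_front A u" "n \<ge> 1"
  shows "has_front A (uf_power u n)"
  using assms(2)
proof (induction n rule: dec_induct)
  case base
  then show ?case using assms(1) by (simp add: uf_power_def)
next
  case (step n)
  then show ?case
    using assms(1) by (simp add: uf_power_Suc uf_plus_eq_indexed_sum has_front_indexed_sum)
qed

lemma uf_plus_neq_left:
  assumes A: "superincreasing A" and "has_front A u" "has_front A v"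
  shows "uf_plus u v \<noteq> u"
proof
  assume eq: "uf_plus u v = u"
  obtain B where B: "front_on A B" "lives_on_front u B"
    using assms(2) has_front_def by blast
  obtain C where C: "front_on A C" "lives_on_front v C"
    using assms(3) has_front_def by blast
  have ev: "eventually (\<lambda>n. \<exists>s\<in>B. n = \<Sum>s) u"
    using B(2) unfolding lives_on_front_def by (blast intro: eventually_mono)
  then have "eventually (\<lambda>n. \<exists>s\<in>B. n = \<Sum>s) (uf_plus u v)"
    by (simp only: eq)
  then have "eventually (\<lambda>n. eventually (\<lambda>m. \<exists>r\<in>B. n + m = \<Sum>r) v) u"
    by (simp add: eventually_uf_plus)
  with ev have "eventually (\<lambda>n. \<exists>s\<in>B. n = \<Sum>s \<and> eventually (\<lambda>m. \<exists>r\<in>B. n + m = \<Sum>r) v) u"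
    by eventually_elim blast
  then obtain s where s: "s \<in> B" "eventually (\<lambda>m. \<exists>r\<in>B. \<Sum>s + m = \<Sum>r) v"
    using B(2) unfolding lives_on_front_def by (blast dest: eventually_happens')
  \<comment> \<open>Since \<open>s\<close> is already fixed, \<open>t\<close> can be taken entirely
    beyond it.\<close>
  have "eventually (\<lambda>m. \<exists>t\<in>C. (\<forall>y\<in>t. Max s < y) \<and> m = \<Sum>t) v"
    using C(2) unfolding lives_on_front_def by blast
  with s(2) have "eventually (\<lambda>m. \<exists>t\<in>C. (\<forall>y\<in>t. Max s < y) \<and> (\<exists>r\<in>B. \<Sum>s + \<Sum>t = \<Sum>r)) v"
    by eventually_elim blast
  then obtain t r where t: "t \<in> C" "\<forall>y\<in>t. Max s < y" and r: "r \<in> B" "\<Sum>s + \<Sum>t = \<Sum>r"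
    using C(2) unfolding lives_on_front_def by (blast dest: eventually_happens')
  have fin: "finite s" "finite t" "finite r" "s \<subseteq> A" "t \<subseteq> A" "r \<subseteq> A" "t \<noteq> {}"
    using B C s r t unfolding front_on_def by blast+
  have less: "x < y" if "x \<in> s" "y \<in> t" for x y
    using that t(2) Max_ge[OF fin(1) that(1)] by fastforce
  then have disj: "s \<inter> t = {}" by fastforce
  then have "\<Sum>(s \<union> t) = \<Sum>r"
    using fin r by (subst sum.union_disjoint) auto
  \<comment> \<open>Uniqueness of sums puts \<open>s \<union> t\<close> itself into
    \<open>B\<close>, next to its proper initial segment \<open>s\<close>.\<close>
  then have "r = s \<union> t"
    using superincreasing_sum_inject[OF A, of "s \<union> t" r] fin by auto
  moreover have "initial_segment s (s \<union> t)"
    using less by (rule initial_segment_Un)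
  ultimately have "s = s \<union> t"
    using B s r unfolding front_on_def by blast
  then show False using disj fin by blast
qed

section \<open>Induction along the levels and conclusion\<close>

lemma sum_level_has_front:
  assumes "Well_order r" "has_front A p"
  shows "\<forall>u\<in>sum_level r p \<alpha>. has_front A u"
proof -
  interpret wo_rel r using assms(1) by (simp add: wo_rel_def)
  show ?thesis
  proof (induction \<alpha> rule: well_order_induct)
    case (1 \<alpha>)
    then have IH: "\<forall>u\<in>sum_level r p \<xi>. has_front A u" if "\<xi> \<in> underS \<alpha>" for \<xi>
      using that by (auto simp: underS_def)
    consider "underS \<alpha> = {}" | \<beta> where "is_succ_of r \<beta> \<alpha>"
      | "underS \<alpha> \<noteq> {}" "\<nexists>\<beta>. is_succ_of r \<beta> \<alpha>" by blast
    then show ?case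
    proof cases
      \<comment> \<open>This also covers any \<alpha> outside \<open>Field r\<close>: it has no
        strict predecessors.\<close>
      case 1
      then show ?thesis using assms by (simp add: sum_level_zero)
    next
      case (2 \<beta>)
      then show ?thesis
        using IH[OF is_succ_of_underS[OF assms(1) 2]] sum_level_succ[OF assms(1) 2]
        by (auto simp: indexed_sums_def intro!: has_front_indexed_sum)
    next
      case 3
      then show ?thesis using IH sum_level_limit[OF assms(1) 3] by blast
    qed
  qed
qed

theorem theorem2p17:
  fixes p :: "nat filter"
  assumes "Q_point p"
  shows "\<forall>u \<in> sum_closure TYPE('i) p. \<forall>n\<ge>1. \<forall>m\<ge>1.
           uf_power u n = uf_power u m \<longleftrightarrow> n = m"
proof (intro ballI allI impI)
  fix u n m
  assume u: "u \<in> sum_closure TYPE('i) p" and nm: "(n::nat) \<ge> 1" "(m::nat) \<ge> 1"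
  obtain A where A: "superincreasing A" "eventually (\<lambda>x. x \<in> A) p"
    using Q_point_superincreasing[OF assms] .
  obtain r :: "'i rel" and \<alpha> where "Well_order r" "u \<in> sum_level r p \<alpha>"
    using u unfolding sum_closure_def by blast
  then have "has_front A u"
    using sum_level_has_front[OF _ has_front_Q_point[OF assms A(2)], of r \<alpha>] by simp
  \<comment> \<open>For \<open>k < l\<close> the larger power splits off the smaller one on the
    left, with remaining exponent \<open>l - k\<close> at least 1.\<close>
  then have neq: "uf_power u k \<noteq> uf_power u l" if "1 \<le> k" "k < l" for k l
    using uf_plus_neq_left[OF A(1), of "uf_power u k" "uf_power u (l - k)"]
      uf_power_add[of k "l - k" u] that by (auto simp: has_front_uf_power)
  show "uf_power u n = uf_power u m \<longleftrightarrow> n = m"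
    using neq[of n m] neq[of m n] nm by (metis linorder_neqE_nat)
qed

end
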